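(* Let $\mathcal{E}$ be a non-trivial finite-dimensional Volterra evolution algebra over a field $\mathbb{K}$ of characteristic zero with structural matrix $A_{\mathcal{E}}$ (in a natural basis). If the associated weighted graph $\Gamma$ is complete, then any derivation of $\mathcal{E}$ is trivial (i.e. equal to zero).
   Context: An evolution algebra over $\mathbb{K}$ is a finite-dimensional $\mathbb{K}$-vector space $\mathcal{E}$ with a bilinear multiplication and a basis $\{e_1,\dots,e_n\}$ (called a natural basis) such that $e_ie_j=0$ for $i\neq j$ and $e_i^2=\sum_{k=1}^n a_{ik}e_k$. The matrix $A_{\mathcal{E}}=(a_{ij})_{i,j=1}^n$ is the structural matrix of $\mathcal{E}$ in this natural basis. The evolution algebra is called a Volterra evolution algebra if $A_{\mathcal{E}}$ is skew-symmetric. It is non-trivial if $A_{\mathcal{E}}\neq 0$. The weighted graph attached to $\mathcal{E}$ relative to the natural basis has vertex set $\{1,\dots,n\}$, edge set $E=\{(i,j): a_{ij}\neq 0\}$ and weights $\omega((i,j))=a_{ij}$. It is complete if every two distinct vertices are connected by an edge, i.e. $a_{ij}\neq 0$ for all $i\neq j$. A derivation of $\mathcal{E}$ is a linear map $D:\mathcal{E}\to\mathcal{E}$ with $D(uv)=D(u)v+uD(v)$ for all $u,v\in\mathcal{E}$. *)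

theory Defs
  imports "HOL-Analysis.Determinants"
begin

text \<open>No associativity, commutativity or unit is assumed. The algebra is carried by the whole
  type \<open>'v\<close>.\<close>

locale bilinear_algebra = vector_space scale
  for scale :: "'k::field \<Rightarrow> 'v::ab_group_add \<Rightarrow> 'v" +
  fixes mult :: "'v \<Rightarrow> 'v \<Rightarrow> 'v"
  assumes linear_mult_left: "Vector_Spaces.linear scale scale (\<lambda>u. mult u v)"
    and linear_mult_right: "Vector_Spaces.linear scale scale (mult u)"
begin

definition derivation :: "('v \<Rightarrow> 'v) \<Rightarrow> bool" where
  "derivation D \<longleftrightarrow> Vector_Spaces.linear scale scale D \<and>
     (\<forall>u v. D (mult u v) = mult (D u) v + mult u (D v))"

end

text \<open>The natural basis \<open>e\<close> is part of the structure, because the structural matrix and the attached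
  graph depend on it. It is indexed by an arbitrary finite type \<open>'n\<close>; the zero algebra, whose
  basis is empty, is thereby left out.\<close>

locale evolution_algebra = bilinear_algebra scale mult
  for scale :: "'k::field \<Rightarrow> 'v::ab_group_add \<Rightarrow> 'v" and mult :: "'v \<Rightarrow> 'v \<Rightarrow> 'v" +
  fixes e :: "'n::finite \<Rightarrow> 'v"
  assumes inj_basis: "inj e"
    and independent_basis: "independent (range e)"
    and span_basis: "span (range e) = UNIV"
    and mult_basis: "i \<noteq> j \<Longrightarrow> mult (e i) (e j) = 0"
begin

definition structural_matrix :: "'k^'n^'n" where
  "structural_matrix = (\<chi> i k. representation (range e) (mult (e i) (e i)) (e k))"

lemma square_basis: "mult (e i) (e i) = (\<Sum>k\<in>UNIV. scale (structural_matrix $ i $ k) (e k))"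
proof -
  have "mult (e i) (e i)
      = (\<Sum>b\<in>range e. scale (representation (range e) (mult (e i) (e i)) b) b)"
    by (rule sum_representation_eq[symmetric]) (auto simp: independent_basis span_basis)
  also have "\<dots> = (\<Sum>k\<in>UNIV. scale (structural_matrix $ i $ k) (e k))"
    by (subst sum.reindex[OF inj_basis]) (simp add: structural_matrix_def)
  finally show ?thesis .
qed

definition nontrivial :: bool where
  "nontrivial \<longleftrightarrow> structural_matrix \<noteq> 0"

end

locale volterra_evolution_algebra = evolution_algebra scale mult e
  for scale :: "'k::field \<Rightarrow> 'v::ab_group_add \<Rightarrow> 'v" and mult :: "'v \<Rightarrow> 'v \<Rightarrow> 'v"
    and e :: "'n::finite \<Rightarrow> 'v" +
  assumes skew_symmetric: "transpose structural_matrix = - structural_matrix"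

record ('i, 'k) weighted_graph =
  vertices :: "'i set"
  edges :: "('i \<times> 'i) set"
  weight :: "'i \<times> 'i \<Rightarrow> 'k"

definition complete_graph :: "('i, 'k) weighted_graph \<Rightarrow> bool" where
  "complete_graph G \<longleftrightarrow>
     (\<forall>i\<in>vertices G. \<forall>j\<in>vertices G. i \<noteq> j \<longrightarrow> (i, j) \<in> edges G)"

text \<open>Weights are meaningful on edges only; off the edge set the total function \<open>weight\<close> is zero.\<close>

definition (in evolution_algebra) attached_graph :: "('n, 'k) weighted_graph" where
  "attached_graph =
     \<lparr>vertices = UNIV,
      edges = {(i, j). structural_matrix $ i $ j \<noteq> 0},
      weight = (\<lambda>(i, j). structural_matrix $ i $ j)\<rparr>"

end

(* Write D(e_i) = sum_k d_ik e_k. Applying D to e_i e_j = 0 gives d_ij e_j^2 + d_ji e_i^2 = 0, whose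
   e_i-coordinate is d_ij a_ji = 0, because skew-symmetry kills a_ii; so D is diagonal. Comparing
   e_k-coordinates in D(e_i^2) = 2 d_ii e_i^2 gives d_kk = 2 d_ii for i \<noteq> k. Exchanging i and k,
   d_ii = 4 d_ii. Nontriviality provides two distinct indices, so each i has such a k. *)
theory Submission
  imports Defs
begin

context evolution_algebra
begin

text \<open>Coordinates are indexed by \<open>'n\<close> instead of by basis vectors, matching
  \<open>structural_matrix\<close>, whose row \<open>i\<close> then consists of the coordinates of
  the square of \<open>e i\<close>.\<close>

definition coord :: "'n \<Rightarrow> 'v \<Rightarrow> 'k" where
  "coord k v = representation (range e) v (e k)"

lemma coord_zero [simp]: "coord k 0 = 0"
  by (simp add: coord_def representation_zero)

lemma coord_add [simp]: "coord k (u + v) = coord k u + coord k v"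
  by (simp add: coord_def representation_add independent_basis span_basis)

lemma coord_scale [simp]: "coord k (scale c v) = c * coord k v"
  by (simp add: coord_def representation_scale independent_basis span_basis)

lemma coord_sum: "coord k (sum f I) = (\<Sum>i\<in>I. coord k (f i))"
  by (induction I rule: infinite_finite_induct) auto

lemma coord_basis: "coord k (e i) = (if i = k then 1 else 0)"
  using inj_basis by (auto simp: coord_def representation_basis independent_basis inj_def)

lemma sum_coord: "(\<Sum>k\<in>UNIV. scale (coord k v) (e k)) = v"
proof -
  have "v = (\<Sum>b\<in>range e. scale (representation (range e) v b) b)"
    by (rule sum_representation_eq[symmetric]) (auto simp: independent_basis span_basis)
  also have "\<dots> = (\<Sum>k\<in>UNIV. scale (coord k v) (e k))"
    by (subst sum.reindex[OF inj_basis]) (simp add: coord_def)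
  finally show ?thesis ..
qed

lemma coord_square_basis: "coord k (mult (e i) (e i)) = structural_matrix $ i $ k"
  by (simp add: coord_def structural_matrix_def)

text \<open>Expand \<open>u\<close> in the natural basis: by \<open>mult_basis\<close> only the
  \<open>e j\<close> term survives. Commutativity is not an axiom of the locale, so the mirror image
  is proved separately.\<close>

lemma mult_basis_right: "mult u (e j) = scale (coord j u) (mult (e j) (e j))"
proof -
  interpret L: Vector_Spaces.linear scale scale "\<lambda>u. mult u (e j)"
    by (rule linear_mult_left)
  have "mult u (e j) = (\<Sum>k\<in>UNIV. scale (coord k u) (mult (e k) (e j)))"
    by (subst sum_coord[of u, symmetric]) (simp add: L.sum L.scale)
  also have "\<dots> = (\<Sum>k\<in>UNIV. if k = j then scale (coord k u) (mult (e k) (e j)) else 0)"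
    by (rule sum.cong) (auto simp: mult_basis)
  finally show ?thesis by simp
qed

lemma mult_basis_left: "mult (e j) u = scale (coord j u) (mult (e j) (e j))"
proof -
  interpret L: Vector_Spaces.linear scale scale "mult (e j)"
    by (rule linear_mult_right)
  have "mult (e j) u = (\<Sum>k\<in>UNIV. scale (coord k u) (mult (e j) (e k)))"
    by (subst sum_coord[of u, symmetric]) (simp add: L.sum L.scale)
  also have "\<dots> = (\<Sum>k\<in>UNIV. if k = j then scale (coord k u) (mult (e j) (e k)) else 0)"
    by (rule sum.cong) (auto simp: mult_basis)
  finally show ?thesis by simp
qed

text \<open>This is the \<open>e k\<close>-coordinate of the Leibniz rule applied to
  \<open>mult (e i) (e j) = 0\<close>; skew-symmetry does not enter yet.\<close>

lemma derivation_orthogonality: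
  assumes "derivation D" "i \<noteq> j"
  shows "coord j (D (e i)) * structural_matrix $ j $ k
       + coord i (D (e j)) * structural_matrix $ i $ k = 0"
proof -
  interpret L: Vector_Spaces.linear scale scale D
    using assms by (simp add: derivation_def)
  have "mult (D (e i)) (e j) + mult (e i) (D (e j)) = D (mult (e i) (e j))"
    using assms by (simp add: derivation_def)
  also have "\<dots> = 0"
    using assms by (simp add: mult_basis L.zero)
  finally have "coord k (mult (D (e i)) (e j) + mult (e i) (D (e j))) = 0"
    by simp
  then show ?thesis
    by (simp add: mult_basis_right[of "D (e i)"] mult_basis_left[of i "D (e j)"] coord_square_basis)
qed

lemma diagonal_derivation_square:
  assumes "derivation D" and diag: "\<And>l. D (e l) = scale (d l) (e l)"
  shows "structural_matrix $ i $ k * d k = 2 * d i * structural_matrix $ i $ k"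
proof -
  interpret L: Vector_Spaces.linear scale scale D
    using assms by (simp add: derivation_def)
  \<comment> \<open>A diagonal map rescales each coordinate separately, so the left side of the
    Leibniz rule for a square can be read off entrywise.\<close>
  have D_coord: "coord k (D v) = coord k v * d k" for v
  proof -
    have "D v = (\<Sum>l\<in>UNIV. scale (coord l v * d l) (e l))"
      by (subst sum_coord[of v, symmetric]) (simp add: L.sum L.scale diag)
    then show ?thesis
      by (simp add: coord_sum coord_basis if_distrib[of "(*) _"] cong: if_cong)
  qed
  have "D (mult (e i) (e i)) = mult (D (e i)) (e i) + mult (e i) (D (e i))"
    using assms by (simp add: derivation_def)
  also have "\<dots> = scale (d i) (mult (e i) (e i)) + scale (d i) (mult (e i) (e i))"
    using mult_basis_right[of "D (e i)" i] mult_basis_left[of i "D (e i)"]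
    by (simp add: diag coord_basis)
  finally have "coord k (D (mult (e i) (e i)))
      = coord k (scale (d i) (mult (e i) (e i)) + scale (d i) (mult (e i) (e i)))"
    by simp
  then show ?thesis
    by (simp add: D_coord coord_square_basis algebra_simps)
qed

end

theorem theorem7p3:
  fixes scale :: "'k::field_char_0 \<Rightarrow> 'v::ab_group_add \<Rightarrow> 'v"
    and mult :: "'v \<Rightarrow> 'v \<Rightarrow> 'v"
    and e :: "'n::finite \<Rightarrow> 'v"
    and D :: "'v \<Rightarrow> 'v"
  assumes "volterra_evolution_algebra scale mult e"
    and "evolution_algebra.nontrivial scale mult e"
    and "complete_graph (evolution_algebra.attached_graph scale mult e)"
    and "bilinear_algebra.derivation scale mult D"
  shows "D = (\<lambda>u. 0)"
proof -
  interpret volterra_evolution_algebra scale mult e by fact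
  interpret L: Vector_Spaces.linear scale scale D
    using assms(4) by (simp add: derivation_def)
  have offdiag: "structural_matrix $ i $ j \<noteq> 0" if "i \<noteq> j" for i j
    using assms(3) that by (simp add: complete_graph_def attached_graph_def)
  have diag: "structural_matrix $ i $ i = 0" for i
  proof -
    have "transpose structural_matrix $ i $ i = (- structural_matrix) $ i $ i"
      by (simp add: skew_symmetric)
    then have "2 * structural_matrix $ i $ i = 0"
      by (simp add: transpose_def eq_neg_iff_add_eq_0)
    \<comment> \<open>Characteristic zero allows cancelling 2.\<close>
    then show ?thesis by simp
  qed
  obtain p q where "structural_matrix $ p $ q \<noteq> 0"
    using assms(2) by (auto simp: nontrivial_def vec_eq_iff)
  then have "p \<noteq> q" using diag by auto
  define d where "d i = coord i (D (e i))" for i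
  have D_basis: "D (e i) = scale (d i) (e i)" for i
  proof -
    have "coord j (D (e i)) = 0" if "j \<noteq> i" for j
      \<comment> \<open>Taking the \<open>e i\<close>-coordinate kills the second summand, which
        carries the zero diagonal entry at \<open>i\<close>; completeness makes the remaining
        factor, the entry at \<open>(j, i)\<close>, cancellable.\<close>
      using derivation_orthogonality[OF assms(4), of i j i] diag[of i] offdiag[of j i] that by auto
    then have "(\<Sum>k\<in>UNIV. scale (coord k (D (e i))) (e k))
        = (\<Sum>k\<in>UNIV. if k = i then scale (d i) (e i) else 0)"
      by (intro sum.cong) (auto simp: d_def)
    then show ?thesis by (simp add: sum_coord)
  qed
  have double: "d k = 2 * d i" if "i \<noteq> k" for i k
    using diagonal_derivation_square[OF assms(4) D_basis, of i k] offdiag[OF that] by simp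
  have "d i = 0" for i
  proof -
    \<comment> \<open>At least one of \<open>p\<close> and \<open>q\<close> differs from
      \<open>i\<close>.\<close>
    obtain k where "i \<noteq> k" using \<open>p \<noteq> q\<close> by metis
    then have "d i = 2 * (2 * d i)" using double[of i k] double[of k i] by simp
    then have "3 * d i = 0" by (simp add: algebra_simps)
    \<comment> \<open>Characteristic zero again, now to cancel 3.\<close>
    then show ?thesis by simp
  qed
  then have zero: "D (e i) = 0" for i by (simp add: D_basis)
  show ?thesis
  proof
    fix u
    show "D u = 0"
      by (subst sum_coord[of u, symmetric]) (simp add: L.sum L.scale zero)
  qed
qed

end
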